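(* Every group $G\subset \mathrm{Diff}^1_+([0,1])$ without hyperbolic fixed points is without linked fixed points.
   Context: $G\subset \mathrm{Diff}^1_+([0,1])$ is without hyperbolic fixed points if for every $g\in G$ and every $x\in\mathrm{Fix}(g)$ one has $Dg(x)=1$. For a group $G$ of homeomorphisms of $[0,1]$, a pair of successive fixed points of $G$ is a pair $\{a,b\}$, $a<b$, such that $(a,b)$ is a connected component of $[0,1]\setminus \mathrm{Fix}(g)$ for some $g\in G$. Two pairs $\{a,b\}$ and $\{c,d\}$ are linked if $(a,b)\cap\{c,d\}$ or $(c,d)\cap\{a,b\}$ consists of exactly one point. $G$ is without linked fixed points if no two pairs of successive fixed points of $G$ are linked. *)

theory Defs
  imports "HOL-Analysis.Analysis"
begin

text \<open>Elements of Diff^1_+([0,1]) are represented as functions real => real that are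
  the identity outside [0,1] (so that equality of maps is equality on [0,1]).
  Derivatives are taken within [0,1] (one-sided at the endpoints).\<close>

definition Diff1_plus :: "(real \<Rightarrow> real) set" where
  "Diff1_plus = {g. (\<forall>x. x \<notin> {0..1} \<longrightarrow> g x = x)
      \<and> bij_betw g {0..1} {0..1}
      \<and> strict_mono_on {0..1} g
      \<and> (\<exists>g'. continuous_on {0..1} g'
            \<and> (\<forall>x\<in>{0..1}. (g has_real_derivative g' x) (at x within {0..1}) \<and> g' x > 0))}"

definition is_group :: "(real \<Rightarrow> real) set \<Rightarrow> bool" where
  "is_group G \<longleftrightarrow> id \<in> G \<and> (\<forall>f\<in>G. \<forall>g\<in>G. f \<circ> g \<in> G)
      \<and> (\<forall>g\<in>G. \<exists>h\<in>G. h \<circ> g = id \<and> g \<circ> h = id)"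

definition Fix :: "(real \<Rightarrow> real) \<Rightarrow> real set" where
  "Fix g = {x \<in> {0..1}. g x = x}"

definition without_hyperbolic_fixed_points :: "(real \<Rightarrow> real) set \<Rightarrow> bool" where
  "without_hyperbolic_fixed_points G \<longleftrightarrow>
     (\<forall>g\<in>G. \<forall>x\<in>Fix g. (g has_real_derivative 1) (at x within {0..1}))"

definition successive_fixed_pair :: "(real \<Rightarrow> real) set \<Rightarrow> real \<Rightarrow> real \<Rightarrow> bool" where
  "successive_fixed_pair G a b \<longleftrightarrow> a < b \<and>
     (\<exists>g\<in>G. \<exists>x. connected_component_set ({0..1} - Fix g) x = {a<..<b})"

definition linked :: "real \<Rightarrow> real \<Rightarrow> real \<Rightarrow> real \<Rightarrow> bool" where
  "linked a b c d \<longleftrightarrow> card ({a<..<b} \<inter> {c, d}) = 1 \<or> card ({c<..<d} \<inter> {a, b}) = 1"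

definition without_linked_fixed_points :: "(real \<Rightarrow> real) set \<Rightarrow> bool" where
  "without_linked_fixed_points G \<longleftrightarrow>
     (\<forall>a b c d. successive_fixed_pair G a b \<and> successive_fixed_pair G c d
        \<longrightarrow> \<not> linked a b c d)"

end

theory Submission
  imports Defs
begin

text \<open>
  If \<open>c\<close> is an endpoint of a fixed-point-free interval \<open>(c,d)\<close> of \<open>g\<close> and lies inside one of
  \<open>f\<close> that does not contain \<open>d\<close>, then composing \<open>f\<close> with an element that contracts towards \<open>c\<close> yields two group elements
  mapping some compact interval \<open>I\<close> into itself with non-overlapping images.  The \<open>2^n\<close> words \<open>w\<close>
  of length \<open>n\<close> in these two elements have images \<open>w I\<close> of total length at most \<open>|I|\<close>, so by
  averaging some word has \<open>|w I| \<le> 3 |I| / 2^n\<close> and the lengths of the intermediate images of \<open>I\<close>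
  sum to at most \<open>3 |I|\<close>.  Uniform continuity of the logarithms of the derivatives then bounds
  the distortion of \<open>w\<close> on \<open>I\<close> by \<open>exp (\<epsilon> n + C)\<close>, so for large \<open>n\<close> the derivative of \<open>w\<close> is
  smaller than \<open>1\<close> on \<open>I\<close>, in particular at a fixed point of \<open>w\<close> in \<open>I\<close>.
\<close>

section \<open>Sums over binary words, and two facts about continuous functions\<close>

lemma sum_lists_length_Suc_Cons:
  fixes F :: "bool list \<Rightarrow> 'a::comm_monoid_add"
  shows "(\<Sum>xs | length xs = Suc n. F xs) = (\<Sum>xs | length xs = n. F (False # xs) + F (True # xs))"
proof -
  let ?A = "{xs :: bool list. length xs = n}"
  have fin: "finite ?A" using finite_lists_length_eq[of "UNIV :: bool set" n] by simp
  have eq: "{xs :: bool list. length xs = Suc n} = Cons False ` ?A \<union> Cons True ` ?A"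
    by (auto simp: length_Suc_conv image_iff)
  have "(\<Sum>xs | length xs = Suc n. F xs) = sum F (Cons False ` ?A) + sum F (Cons True ` ?A)"
    unfolding eq using fin by (intro sum.union_disjoint) auto
  then show ?thesis
    by (simp add: sum.reindex sum.distrib)
qed

text \<open>Both splittings are needed: in \<open>word_map\<close> the first letter acts last, so
  removing it steps back along an orbit, whereas appending a last letter passes to a subinterval of
  the image.\<close>

lemma sum_lists_length_Suc_snoc:
  fixes F :: "bool list \<Rightarrow> 'a::comm_monoid_add"
  shows "(\<Sum>xs | length xs = Suc n. F xs) = (\<Sum>xs | length xs = n. F (xs @ [False]) + F (xs @ [True]))"
proof -
  have rev: "(\<Sum>xs | length xs = m. H xs) = (\<Sum>xs | length xs = m. H (rev xs))"
    for m and H :: "bool list \<Rightarrow> 'a"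
    by (rule sum.reindex_bij_witness[of _ rev rev]) auto
  have "(\<Sum>xs | length xs = Suc n. F xs) = (\<Sum>xs | length xs = n. F (rev xs @ [False]) + F (rev xs @ [True]))"
    by (subst rev) (simp add: sum_lists_length_Suc_Cons)
  also have "\<dots> = (\<Sum>xs | length xs = n. F (xs @ [False]) + F (xs @ [True]))"
    using rev[of "\<lambda>xs. F (xs @ [False]) + F (xs @ [True])" n] by simp
  finally show ?thesis .
qed

text \<open>Nearby points are covered by \<open>\<epsilon>\<close>; points at distance at least
  \<open>\<delta>\<close> by the linear term, since \<open>h\<close> is bounded. A bound affine in
  the distance can be summed along an orbit, giving \<open>\<epsilon>\<close> per letter plus a
  multiple of the total length.\<close>

lemma continuous_on_compact_diff_le:
  fixes h :: "'a::metric_space \<Rightarrow> real"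
  assumes "compact S" "continuous_on S h" "\<epsilon> > 0"
  obtains C where "C \<ge> 0" "\<And>x y. x \<in> S \<Longrightarrow> y \<in> S \<Longrightarrow> h x - h y \<le> \<epsilon> + C * dist x y"
proof -
  obtain \<delta> where \<delta>: "\<delta> > 0" "\<And>x y. x \<in> S \<Longrightarrow> y \<in> S \<Longrightarrow> dist x y < \<delta> \<Longrightarrow> dist (h x) (h y) < \<epsilon>"
    using compact_uniformly_continuous[OF assms(2,1)] \<open>\<epsilon> > 0\<close>
    unfolding uniformly_continuous_on_def by metis
  obtain B where B: "\<And>x. x \<in> S \<Longrightarrow> \<bar>h x\<bar> \<le> B" and "B > 0"
    using compact_imp_bounded[OF compact_continuous_image[OF assms(2,1)]]
    unfolding bounded_pos by auto
  have "h x - h y \<le> \<epsilon> + 2 * B / \<delta> * dist x y" if "x \<in> S" "y \<in> S" for x y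
  proof (cases "dist x y < \<delta>")
    case True
    have "0 \<le> 2 * B / \<delta> * dist x y" using \<open>B > 0\<close> \<open>\<delta> > 0\<close> by simp
    with \<delta>(2)[OF that True] show ?thesis by (simp add: dist_real_def)
  next
    case False
    then have "2 * B \<le> 2 * B / \<delta> * dist x y"
      using \<open>B > 0\<close> \<open>\<delta> > 0\<close> by (simp add: field_simps)
    with B[OF that(1)] B[OF that(2)] \<open>\<epsilon> > 0\<close> show ?thesis by linarith
  qed
  moreover have "2 * B / \<delta> \<ge> 0" using \<open>B > 0\<close> \<open>\<delta> > 0\<close> by simp
  ultimately show ?thesis using that by blast
qed

text \<open>The iterates of \<open>y\<close> decrease and stay in \<open>{c..y}\<close>; by
  continuity their limit is a fixed point of \<open>h\<close>, hence \<open>c\<close>.\<close>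

lemma iterates_approach_fixed_point:
  fixes h :: "real \<Rightarrow> real"
  assumes cont: "continuous_on {c..y} h" and mono: "mono_on {c..y} h"
    and "h c = c" "c < y" "h y \<le> y"
    and nofix: "\<And>x. c < x \<Longrightarrow> x \<le> y \<Longrightarrow> h x \<noteq> x" and "c < t"
  shows "\<exists>m. (h ^^ m) y < t"
proof -
  define X where "X m = (h ^^ m) y" for m
  have X: "c \<le> X m \<and> X m \<le> y \<and> X (Suc m) \<le> X m" for m
  proof (induction m)
    case 0
    show ?case using assms by (simp add: X_def)
  next
    case (Suc m)
    have "h c \<le> h (X m)" "h (X (Suc m)) \<le> h (X m)"
      using Suc \<open>c < y\<close> mono_onD[OF mono, of c "X m"]
        mono_onD[OF mono, of "X (Suc m)" "X m"] \<open>h c = c\<close>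
      by (auto simp: X_def)
    then show ?case using Suc \<open>h c = c\<close> by (auto simp: X_def)
  qed
  have "decseq X" using X by (simp add: decseq_SucI)
  then obtain L where L: "X \<longlonglongrightarrow> L" using X decseq_convergent by metis
  have L_mem: "L \<in> {c..y}"
    using X LIMSEQ_le_const[OF L, of c] LIMSEQ_le_const2[OF L, of y] by auto
  have "(\<lambda>m. h (X m)) \<longlonglongrightarrow> h L"
    using continuous_on_tendsto_compose[OF cont L L_mem] X by auto
  moreover have "(\<lambda>m. h (X m)) \<longlonglongrightarrow> L"
    using LIMSEQ_Suc[OF L] by (simp add: X_def)
  ultimately have "h L = L" using LIMSEQ_unique by blast
  then have "L = c" using L_mem nofix[of L] by force
  then have "eventually (\<lambda>m. X m < t) sequentially"
    using L \<open>c < t\<close> order_tendstoD(2) by blast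
  then show ?thesis unfolding X_def by (auto simp: eventually_sequentially)
qed

section \<open>Words in two maps\<close>

primrec word_map :: "('i \<Rightarrow> 'a \<Rightarrow> 'a) \<Rightarrow> 'i list \<Rightarrow> 'a \<Rightarrow> 'a" where
  "word_map s [] = id"
| "word_map s (i # w) = s i \<circ> word_map s w"

lemma word_map_snoc: "word_map s (w @ [i]) x = word_map s w (s i x)"
  by (induction w) auto

text \<open>The last three assumptions put the two images of \<open>{u..v}\<close> side by side
  inside that interval. A common endpoint is harmless, since only lengths are compared.\<close>

locale ping_pong =
  fixes s :: "bool \<Rightarrow> real \<Rightarrow> real" and s' :: "bool \<Rightarrow> real \<Rightarrow> real" and u v :: real
  assumes uv: "0 \<le> u" "u < v" "v \<le> 1"
    and maps: "\<And>i x. x \<in> {0..1} \<Longrightarrow> s i x \<in> {0..1}"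
    and mono: "\<And>i. strict_mono_on {0..1} (s i)"
    and deriv: "\<And>i x. x \<in> {0..1} \<Longrightarrow> (s i has_real_derivative s' i x) (at x within {0..1})"
    and deriv_pos: "\<And>i x. x \<in> {0..1} \<Longrightarrow> s' i x > 0"
    and deriv_cont: "\<And>i. continuous_on {0..1} (s' i)"
    and left: "u \<le> s False u" and middle: "s False v \<le> s True u" and right: "s True v \<le> v"
begin

definition len :: "bool list \<Rightarrow> real" where
  "len w = word_map s w v - word_map s w u"

text \<open>One term per letter: the length of the interval to which that letter is applied. For a
  nonempty word \<open>{u..v}\<close> itself is counted and the final image is not, matching the
  points at which \<open>word_deriv\<close> evaluates \<open>s'\<close>.\<close>

primrec total_len :: "bool list \<Rightarrow> real" where
  "total_len [] = 0"
| "total_len (i # w) = total_len w + len w"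

primrec word_deriv :: "bool list \<Rightarrow> real \<Rightarrow> real" where
  "word_deriv [] x = 1"
| "word_deriv (i # w) x = s' i (word_map s w x) * word_deriv w x"

lemma word_map_in: "x \<in> {0..1} \<Longrightarrow> word_map s w x \<in> {0..1}"
  by (induction w) (use maps in auto)

lemma word_map_strict_mono: "strict_mono_on {0..1} (word_map s w)"
proof (induction w)
  case Nil
  show ?case by (simp add: strict_mono_on_def)
next
  case (Cons i w)
  show ?case
    unfolding strict_mono_on_def
    using strict_mono_onD[OF mono] strict_mono_onD[OF Cons] word_map_in by simp
qed

lemma word_map_mono: "0 \<le> x \<Longrightarrow> x \<le> y \<Longrightarrow> y \<le> 1 \<Longrightarrow> word_map s w x \<le> word_map s w y"
  using strict_mono_on_leD[OF word_map_strict_mono] by simp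

lemma s_mono: "0 \<le> x \<Longrightarrow> x \<le> y \<Longrightarrow> y \<le> 1 \<Longrightarrow> s i x \<le> s i y"
  using word_map_mono[of x y "[i]"] by simp

lemma word_deriv:
  "x \<in> {0..1} \<Longrightarrow> (word_map s w has_real_derivative word_deriv w x) (at x within {0..1})"
proof (induction w)
  case Nil
  show ?case by (simp add: id_def)
next
  case (Cons i w)
  have "(s i has_real_derivative s' i (word_map s w x))
          (at (word_map s w x) within word_map s w ` {0..1})"
    using Cons.prems word_map_in by (intro DERIV_subset[OF deriv]) auto
  from DERIV_image_chain[OF this Cons.IH[OF Cons.prems]] show ?case
    by (simp only: word_map.simps word_deriv.simps)
qed

lemma word_deriv_pos: "x \<in> {0..1} \<Longrightarrow> word_deriv w x > 0"
  by (induction w) (use deriv_pos word_map_in in auto)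

lemma word_map_continuous: "continuous_on {0..1} (word_map s w)"
  using word_deriv DERIV_continuous continuous_on_eq_continuous_within by blast

lemma s_trap:
  assumes "x \<in> {u..v}" shows "s i x \<in> {u..v}"
proof -
  \<comment> \<open>The inequality for the other index completes the chain \<open>u \<le> s False u
    \<le> s False v \<le> s True u \<le> s True v \<le> v\<close>.\<close>
  have "s i u \<le> s i x" "s i x \<le> s i v" "s (\<not> i) u \<le> s (\<not> i) v"
    using assms uv by (auto intro: s_mono)
  then show ?thesis
    using left middle right by (cases i) auto
qed

lemma word_map_trap: "x \<in> {u..v} \<Longrightarrow> word_map s w x \<in> {u..v}"
  by (induction w) (use s_trap in auto)

section \<open>Lengths of the images of \<open>{u..v}\<close> under words\<close>

lemma len_pos: "len w > 0"
  using strict_mono_onD[OF word_map_strict_mono, of u v w] uv by (simp add: len_def)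

lemma total_len_nonneg: "total_len w \<ge> 0"
  by (induction w) (use len_pos in \<open>auto intro: add_nonneg_nonneg less_imp_le\<close>)

text \<open>The increasing map \<open>word_map s w\<close> carries the two side-by-side images to
  non-overlapping subintervals of the image of \<open>{u..v}\<close>.\<close>

lemma len_snoc: "len (w @ [False]) + len (w @ [True]) \<le> len w"
proof -
  have "s False u \<in> {u..v}" "s False v \<in> {u..v}" "s True u \<in> {u..v}" "s True v \<in> {u..v}"
    using uv by (auto intro!: s_trap[unfolded atLeastAtMost_iff])
  then have "word_map s w u \<le> word_map s w (s False u)"
    "word_map s w (s False v) \<le> word_map s w (s True u)"
    "word_map s w (s True v) \<le> word_map s w v"
    using uv middle by (auto intro: word_map_mono)
  then show ?thesis by (simp add: len_def word_map_snoc)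
qed

lemma sum_len_le: "(\<Sum>w | length w = n. len w) \<le> v - u"
proof (induction n)
  case 0
  show ?case by (simp add: len_def)
next
  case (Suc n)
  have "(\<Sum>w | length w = Suc n. len w) \<le> (\<Sum>w | length w = n. len w)"
    unfolding sum_lists_length_Suc_snoc by (intro sum_mono len_snoc)
  then show ?case using Suc by linarith
qed

text \<open>Each word of length \<open>n\<close> is the tail of exactly two words of length
  \<open>n + 1\<close>. So each step doubles the sum of \<open>total_len\<close> and adds twice the
  sum of \<open>len\<close>, which is at most \<open>v - u\<close>.\<close>

lemma sum_total_len_le: "(\<Sum>w | length w = n. total_len w) \<le> 2 * (2 ^ n - 1) * (v - u)"
proof (induction n)
  case 0
  show ?case by simp
next
  case (Suc n)
  have "(\<Sum>w | length w = Suc n. total_len w)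
      = 2 * (\<Sum>w | length w = n. total_len w) + 2 * (\<Sum>w | length w = n. len w)"
    by (simp add: sum_lists_length_Suc_Cons sum.distrib sum_distrib_left)
  also have "\<dots> \<le> 2 * (2 * (2 ^ n - 1) * (v - u)) + 2 * (v - u)"
    by (intro add_mono mult_left_mono Suc sum_len_le) simp_all
  also have "\<dots> = 2 * (2 ^ Suc n - 1) * (v - u)" by (simp add: algebra_simps)
  finally show ?case .
qed

lemma ex_short_word:
  obtains w where "length w = n" "len w \<le> 3 * (v - u) / 2 ^ n" "total_len w \<le> 3 * (v - u)"
proof -
  let ?A = "{w :: bool list. length w = n}"
  \<comment> \<open>The weight \<open>2 ^ n\<close> brings both sums to the same order, so one
    averaging argument bounds both nonnegative summands for a single word.\<close>
  let ?F = "\<lambda>w. 2 ^ n * len w + total_len w"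
  have card: "card ?A = 2 ^ n"
    using card_lists_length_eq[of "UNIV :: bool set" n] by simp
  have "\<exists>w\<in>?A. ?F w \<le> 3 * (v - u)"
  proof (rule ccontr)
    assume "\<not> ?thesis"
    then have "(\<Sum>w\<in>?A. 3 * (v - u)) \<le> (\<Sum>w\<in>?A. ?F w)"
      by (intro sum_mono) force
    also have "\<dots> = 2 ^ n * (\<Sum>w\<in>?A. len w) + (\<Sum>w\<in>?A. total_len w)"
      by (simp add: sum.distrib sum_distrib_left)
    also have "\<dots> \<le> 2 ^ n * (v - u) + 2 * (2 ^ n - 1) * (v - u)"
      by (intro add_mono mult_left_mono sum_len_le sum_total_len_le) simp
    also have "\<dots> = 3 * 2 ^ n * (v - u) - 2 * (v - u)" by (simp add: algebra_simps)
    also have "\<dots> < 3 * 2 ^ n * (v - u)" using uv by simp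
    finally show False by (simp add: card)
  qed
  then obtain w where w: "length w = n" "?F w \<le> 3 * (v - u)" by blast
  have "2 ^ n * len w \<le> 3 * (v - u)" using w total_len_nonneg[of w] by linarith
  then have "len w \<le> 3 * (v - u) / 2 ^ n" by (simp add: field_simps)
  moreover have "0 \<le> 2 ^ n * len w" using len_pos[of w] by simp
  with w have "total_len w \<le> 3 * (v - u)" by linarith
  ultimately show ?thesis using that w by blast
qed

section \<open>Distortion and the contracting word\<close>

lemma ln_deriv_diff_le:
  assumes "\<epsilon> > 0"
  obtains C where "C \<ge> 0"
    "\<And>i x y. x \<in> {0..1} \<Longrightarrow> y \<in> {0..1} \<Longrightarrow> s' i x \<le> s' i y * exp (\<epsilon> + C * \<bar>x - y\<bar>)"
proof -
  have "\<exists>C\<ge>0. \<forall>x\<in>{0..1}. \<forall>y\<in>{0..1}. ln (s' i x) - ln (s' i y) \<le> \<epsilon> + C * dist x y" for i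
  proof -
    have "continuous_on {0..1} (\<lambda>x. ln (s' i x))"
      using deriv_pos[of _ i] by (intro continuous_on_ln deriv_cont) force
    from continuous_on_compact_diff_le[OF compact_Icc this assms] show ?thesis by metis
  qed
  then obtain C where C0: "\<And>i. C i \<ge> 0"
    and C: "\<And>i x y. x \<in> {0..1} \<Longrightarrow> y \<in> {0..1} \<Longrightarrow> ln (s' i x) - ln (s' i y) \<le> \<epsilon> + C i * dist x y"
    by metis
  have "s' i x \<le> s' i y * exp (\<epsilon> + (C False + C True) * \<bar>x - y\<bar>)"
    if xy: "x \<in> {0..1}" "y \<in> {0..1}" for i x y
  proof -
    have "C i \<le> C False + C True" using C0 by (cases i) auto
    then have "C i * \<bar>x - y\<bar> \<le> (C False + C True) * \<bar>x - y\<bar>" by (rule mult_right_mono) simp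
    with C[OF xy, of i] have "ln (s' i x) \<le> ln (s' i y) + (\<epsilon> + (C False + C True) * \<bar>x - y\<bar>)"
      by (simp add: dist_real_def)
    then have "exp (ln (s' i x)) \<le> exp (ln (s' i y) + (\<epsilon> + (C False + C True) * \<bar>x - y\<bar>))"
      by (simp only: exp_le_cancel_iff)
    then show ?thesis using deriv_pos[OF xy(1), of i] deriv_pos[OF xy(2), of i]
      by (simp add: exp_add[of "ln _"])
  qed
  then show ?thesis using that C0 by (meson add_nonneg_nonneg)
qed

text \<open>The mean slope of \<open>word_map s w\<close> on \<open>{u..v}\<close> is
  \<open>len w / (v - u)\<close>. A new letter multiplies it by \<open>s' i \<xi>\<close> for a mean
  value point \<open>\<xi>\<close>, and the derivative at \<open>p\<close> by \<open>s' i z\<close>.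
  Both points lie in an interval of length \<open>len w\<close>, so the mismatch is at most
  \<open>exp (\<epsilon> + C * len w)\<close>.\<close>

lemma word_deriv_le:
  assumes C: "C \<ge> 0"
    "\<And>i x y. x \<in> {0..1} \<Longrightarrow> y \<in> {0..1} \<Longrightarrow> s' i x \<le> s' i y * exp (\<epsilon> + C * \<bar>x - y\<bar>)"
    and p: "p \<in> {u..v}"
  shows "word_deriv w p \<le> len w / (v - u) * exp (\<epsilon> * length w + C * total_len w)"
proof (induction w)
  case Nil
  show ?case using uv by (simp add: len_def)
next
  case (Cons i w)
  define x y z where "x = word_map s w u" and "y = word_map s w v" and "z = word_map s w p"
  have in01: "x \<in> {0..1}" "y \<in> {0..1}" "z \<in> {0..1}"
    unfolding x_def y_def z_def using uv p by (auto intro!: word_map_in[unfolded atLeastAtMost_iff])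
  have xz: "x \<le> z" "z \<le> y"
    unfolding x_def y_def z_def using uv p by (auto intro: word_map_mono)
  have xy: "x < y" and len: "len w = y - x" using len_pos[of w] by (auto simp: len_def x_def y_def)
  have "\<exists>\<xi>\<in>{x<..<y}. s i y - s i x = s' i \<xi> * (y - x)"
  proof -
    have "(s i has_derivative (*) (s' i t)) (at t within {x..y})" if "x \<le> t" "t \<le> y" for t
      using that in01 DERIV_subset[OF deriv, of t "{x..y}" i]
      by (auto simp: has_field_derivative_def)
    from mvt_simple[OF xy this] show ?thesis .
  qed
  then obtain \<xi> where \<xi>: "\<xi> \<in> {x<..<y}" "s i y - s i x = s' i \<xi> * (y - x)" by blast
  have \<xi>01: "\<xi> \<in> {0..1}" using \<xi> in01 by auto
  have len_Cons: "len (i # w) = s' i \<xi> * len w" using \<xi> by (simp add: len_def x_def y_def)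
  have "s' i z \<le> s' i \<xi> * exp (\<epsilon> + C * \<bar>z - \<xi>\<bar>)" by (rule C(2)[OF in01(3) \<xi>01])
  also have "\<dots> \<le> s' i \<xi> * exp (\<epsilon> + C * len w)"
    using \<xi> xz deriv_pos[OF \<xi>01, of i] C(1) by (auto simp: len intro!: mult_left_mono)
  finally have "word_deriv (i # w) p \<le> s' i \<xi> * exp (\<epsilon> + C * len w) *
      (len w / (v - u) * exp (\<epsilon> * length w + C * total_len w))"
    unfolding word_deriv.simps z_def[symmetric]
    using Cons deriv_pos[OF \<xi>01, of i] word_deriv_pos[of p w] p uv
    by (intro mult_mono) (auto intro: less_imp_le)
  also have "\<dots> = len (i # w) / (v - u) * exp (\<epsilon> * length (i # w) + C * total_len (i # w))"
    by (simp add: len_Cons exp_add algebra_simps)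
  finally show ?case .
qed

theorem ex_contracting_fixed_point:
  obtains w p where "p \<in> {u..v}" "word_map s w p = p" "word_deriv w p < 1"
proof -
  \<comment> \<open>The distortion then grows like \<open>(3/2) ^ n\<close> while the length shrinks
    like \<open>1 / 2 ^ n\<close>, leaving \<open>(3/4) ^ n\<close>.\<close>
  define \<epsilon> where "\<epsilon> = ln (3/2 :: real)"
  have "\<epsilon> > 0" by (simp add: \<epsilon>_def)
  then obtain C where C: "C \<ge> 0"
    "\<And>i x y. x \<in> {0..1} \<Longrightarrow> y \<in> {0..1} \<Longrightarrow> s' i x \<le> s' i y * exp (\<epsilon> + C * \<bar>x - y\<bar>)"
    using ln_deriv_diff_le by metis
  \<comment> \<open>\<open>K\<close> collects the factors independent of \<open>n\<close>: the 3
    from the bound on \<open>len w\<close> and the distortion due to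
    \<open>total_len w\<close>.\<close>
  define K where "K = 3 * exp (C * (3 * (v - u)))"
  have "K > 0" by (simp add: K_def)
  obtain n where "(3/4 :: real) ^ n < 1 / K"
    using real_arch_pow_inv[of "1 / K" "3/4"] \<open>K > 0\<close> by auto
  then have n: "K * (3/4) ^ n < 1" using \<open>K > 0\<close> by (simp add: field_simps)
  obtain w where w: "length w = n" "len w \<le> 3 * (v - u) / 2 ^ n" "total_len w \<le> 3 * (v - u)"
    by (rule ex_short_word)
  have small: "word_deriv w p < 1" if "p \<in> {u..v}" for p
  proof -
    have "word_deriv w p \<le> len w / (v - u) * exp (\<epsilon> * n + C * total_len w)"
      using word_deriv_le[OF C that, of w] w by simp
    also have "\<dots> \<le> 3 / 2 ^ n * exp (\<epsilon> * n + C * (3 * (v - u)))"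
    proof (rule mult_mono)
      show "len w / (v - u) \<le> 3 / 2 ^ n" using w uv by (simp add: field_simps)
      show "exp (\<epsilon> * n + C * total_len w) \<le> exp (\<epsilon> * n + C * (3 * (v - u)))"
        using w(3) C(1) by (simp add: mult_left_mono del: distrib_left_numeral)
    qed simp_all
    also have "exp (\<epsilon> * n + C * (3 * (v - u))) = (3/2) ^ n * exp (C * (3 * (v - u)))"
      by (simp add: exp_add \<epsilon>_def exp_of_nat2_mult)
    also have "3 / 2 ^ n * \<dots> = K * (3/4) ^ n"
      by (simp add: K_def power_divide field_simps flip: power_mult_distrib)
    finally show ?thesis using n by linarith
  qed
  have "continuous_on {u..v} (\<lambda>x. word_map s w x - x)"
    using uv by (intro continuous_intros continuous_on_subset[OF word_map_continuous]) auto
  \<comment> \<open>The word maps \<open>{u..v}\<close> into itself, so the difference is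
    nonnegative at \<open>u\<close> and nonpositive at \<open>v\<close>.\<close>
  then obtain p where "u \<le> p" "p \<le> v" "word_map s w p - p = 0"
    using IVT2'[of "\<lambda>x. word_map s w x - x" v 0 u] word_map_trap[of u w] word_map_trap[of v w] uv
    by auto
  then show ?thesis using that small by simp
qed

end

section \<open>Successive fixed points, and groups without hyperbolic fixed points\<close>

lemma successive_fixed_pairE:
  assumes "successive_fixed_pair G a b"
  obtains g where "g \<in> G" "a < b" "0 \<le> a" "b \<le> 1" "g a = a" "g b = b"
    "\<And>x. a < x \<Longrightarrow> x < b \<Longrightarrow> g x \<noteq> x"
proof -
  obtain g x where "g \<in> G" "a < b"
    and comp: "connected_component_set ({0..1} - Fix g) x = {a<..<b}"
    using assms unfolding successive_fixed_pair_def by blast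
  have sub: "{a<..<b} \<subseteq> {0..1} - Fix g"
    using comp connected_component_subset by metis
  then have "closure {a<..<b} \<subseteq> {0..1}" by (intro closure_minimal) auto
  then have ab: "0 \<le> a" "b \<le> 1" using \<open>a < b\<close> by auto
  have x: "x \<in> {a<..<b}"
    using \<open>a < b\<close> comp by (metis connected_component_eq_empty connected_component_refl_eq
        greaterThanLessThan_empty_iff mem_Collect_eq not_le)
  \<comment> \<open>An endpoint moved by \<open>g\<close> could be added to the interval, keeping it
    connected and off \<open>Fix g\<close>, against the maximality of the component.\<close>
  have "g e = e" if e: "e = a \<or> e = b" for e
  proof (rule ccontr)
    assume "g e \<noteq> e"
    then have "insert e {a<..<b} \<subseteq> {0..1} - Fix g"
      using sub e ab \<open>a < b\<close> by (auto simp: Fix_def)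
    moreover have "connected (insert e {a<..<b})"
      by (rule connected_intermediate_closure[of "{a<..<b}"]) (use e \<open>a < b\<close> in auto)
    ultimately have "insert e {a<..<b} \<subseteq> {a<..<b}"
      using connected_component_maximal[of x "insert e {a<..<b}"] x comp by auto
    then show False using e by auto
  qed
  moreover have "g y \<noteq> y" if "a < y" "y < b" for y
    using sub that ab by (auto simp: Fix_def)
  ultimately show ?thesis using that \<open>g \<in> G\<close> \<open>a < b\<close> ab by blast
qed

locale parabolic_group =
  fixes G :: "(real \<Rightarrow> real) set"
  assumes sub_Diff1: "G \<subseteq> Diff1_plus" and group: "is_group G"
    and parabolic: "without_hyperbolic_fixed_points G"
begin

lemma comp_in: "f \<in> G \<Longrightarrow> g \<in> G \<Longrightarrow> f \<circ> g \<in> G"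
  using group by (simp add: is_group_def)

lemma inverseE:
  assumes "g \<in> G"
  obtains h where "h \<in> G" "\<And>x. h (g x) = x" "\<And>x. g (h x) = x"
proof -
  obtain h where "h \<in> G" "h \<circ> g = id" "g \<circ> h = id"
    using assms group unfolding is_group_def by blast
  then show ?thesis using that by (simp add: fun_eq_iff)
qed

lemma funpow_in: "g \<in> G \<Longrightarrow> g ^^ n \<in> G"
  using group by (induction n) (auto simp: is_group_def id_def)

lemma word_map_in_group: "(\<And>i. s i \<in> G) \<Longrightarrow> word_map s w \<in> G"
  using group by (induction w) (auto simp: is_group_def)

lemma strict_monoD: "g \<in> G \<Longrightarrow> 0 \<le> x \<Longrightarrow> x < y \<Longrightarrow> y \<le> 1 \<Longrightarrow> g x < g y"
  using sub_Diff1 by (auto simp: Diff1_plus_def strict_mono_on_def)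

lemma maps_unit: "g \<in> G \<Longrightarrow> x \<in> {0..1} \<Longrightarrow> g x \<in> {0..1}"
  using sub_Diff1 unfolding Diff1_plus_def bij_betw_def by blast

lemma C1E:
  assumes "g \<in> G"
  obtains g' where "continuous_on {0..1} g'"
    "\<And>x. x \<in> {0..1} \<Longrightarrow> (g has_real_derivative g' x) (at x within {0..1})"
    "\<And>x. x \<in> {0..1} \<Longrightarrow> g' x > 0"
  using assms sub_Diff1 unfolding Diff1_plus_def by blast

lemma continuous: "g \<in> G \<Longrightarrow> continuous_on {0..1} g"
  unfolding continuous_on_eq_continuous_within by (erule C1E) (blast intro: DERIV_continuous)

lemma no_ping_pong:
  assumes "\<phi> \<in> G" "\<psi> \<in> G" "0 \<le> u" "u < v" "v \<le> 1"
    and "u \<le> \<phi> u" "\<phi> v \<le> \<psi> u" "\<psi> v \<le> v"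
  shows False
proof -
  define s where "s i = (if i then \<psi> else \<phi>)" for i
  have s_in: "s i \<in> G" for i using assms by (simp add: s_def)
  have "\<exists>g'. continuous_on {0..1} g' \<and>
      (\<forall>x\<in>{0..1}. (s i has_real_derivative g' x) (at x within {0..1}) \<and> g' x > 0)" for i
    using C1E[OF s_in[of i]] by metis
  then obtain s' where s': "\<And>i. continuous_on {0..1} (s' i)"
    "\<And>i x. x \<in> {0..1} \<Longrightarrow> (s i has_real_derivative s' i x) (at x within {0..1})"
    "\<And>i x. x \<in> {0..1} \<Longrightarrow> s' i x > 0"
    by metis
  interpret ping_pong s s' u v
  proof
    show "s i x \<in> {0..1}" if "x \<in> {0..1}" for i x
      using that maps_unit[OF s_in] by blast
    show "strict_mono_on {0..1} (s i)" for i
      using s_in[of i] sub_Diff1 unfolding Diff1_plus_def by blast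
  qed (use assms s' in \<open>auto simp: s_def\<close>)
  obtain w p where wp: "p \<in> {u..v}" "word_map s w p = p" "word_deriv w p < 1"
    by (rule ex_contracting_fixed_point)
  then have p: "p \<in> {0..1}" using uv by auto
  have "(word_map s w has_real_derivative 1) (at p within {0..1})"
    using parabolic word_map_in_group[of s w, OF s_in] wp(2) p
    unfolding without_hyperbolic_fixed_points_def Fix_def by blast
  \<comment> \<open>Derivatives within \<open>{0..1}\<close> are unique at \<open>p\<close>, even at
    an end of the interval, so the value below 1 contradicts the value 1.\<close>
  moreover have "at p within {0..1} \<noteq> bot"
    using p by (simp add: trivial_limit_within islimpt_Icc)
  ultimately have "word_deriv w p = 1"
    using word_deriv[OF p, of w] tendsto_unique unfolding has_field_derivative_iff by blast
  then show False using wp(3) by simp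
qed

section \<open>Pushing points within a fixed-point-free interval, and excluding linked pairs\<close>

lemma ex_push_left:
  assumes g: "g \<in> G" "0 \<le> c" "d \<le> 1" "g c = c" "g d = d"
    "\<And>x. c < x \<Longrightarrow> x < d \<Longrightarrow> g x \<noteq> x"
    and y: "c < y" "y < d" and t: "c < t"
  obtains h where "h \<in> G" "h c = c" "h d = d" "h y < t"
proof -
  obtain k where k: "k \<in> G" "\<And>x. k (g x) = x" "\<And>x. g (k x) = x"
    using inverseE[OF g(1)] by blast
  \<comment> \<open>One of \<open>g\<close> and its inverse does not move \<open>y\<close> to the
    right, and both have the same fixed points.\<close>
  have "\<exists>h\<in>G. h c = c \<and> h d = d \<and> h y \<le> y \<and> (\<forall>x. c < x \<and> x < d \<longrightarrow> h x \<noteq> x)"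
  proof (cases "g y \<le> y")
    case True
    then show ?thesis using g by blast
  next
    case False
    have "k y < y"
    proof (rule ccontr)
      assume "\<not> k y < y"
      moreover have "k y < k d" using strict_monoD[OF k(1), of y d] y g by auto
      moreover have "k d = d" using k(2)[of d] g by simp
      ultimately have "g y \<le> g (k y)"
        using strict_monoD[OF g(1), of y "k y"] y g by (cases "y = k y") auto
      then show False using False k(3) by simp
    qed
    moreover have "k x \<noteq> x" if "c < x" "x < d" for x using that g k by metis
    ultimately show ?thesis using k g by (metis less_imp_le)
  qed
  then obtain h where h: "h \<in> G" "h c = c" "h d = d" "h y \<le> y"
    "\<And>x. c < x \<Longrightarrow> x < d \<Longrightarrow> h x \<noteq> x" by blast
  have "continuous_on {c..y} h" using continuous[OF h(1)] g y by (auto elim: continuous_on_subset)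
  moreover have "mono_on {c..y} h"
    using strict_monoD[OF h(1)] g y by (auto intro!: mono_onI simp: order_le_less)
  ultimately obtain m where m: "(h ^^ m) y < t"
    using iterates_approach_fixed_point[of c y h t] h y t by auto
  have "(h ^^ m) c = c" "(h ^^ m) d = d" using h by (induction m) auto
  then show ?thesis using that funpow_in[OF h(1)] m by blast
qed

text \<open>If \<open>h\<close> pushes \<open>t\<close> to the left of \<open>y\<close>, its inverse
  pushes \<open>y\<close> to the right of \<open>t\<close>.\<close>

lemma ex_push_right:
  assumes g: "g \<in> G" "0 \<le> c" "d \<le> 1" "g c = c" "g d = d"
    "\<And>x. c < x \<Longrightarrow> x < d \<Longrightarrow> g x \<noteq> x"
    and y: "c < y" "y < d" and t: "c < t" "t < d"
  obtains h where "h \<in> G" "h c = c" "h d = d" "t < h y"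
proof -
  obtain h where h: "h \<in> G" "h c = c" "h d = d" "h t < y"
    using ex_push_left[OF g t y(1)] by blast
  obtain k where k: "k \<in> G" "\<And>x. k (h x) = x" "\<And>x. h (k x) = x"
    using inverseE[OF h(1)] by blast
  have "h c < h t" using strict_monoD[OF h(1), of c t] g t by auto
  then have "k (h t) < k y" using strict_monoD[OF k(1), of "h t" y] h g y by auto
  then show ?thesis using that[OF k(1)] k(2) h by metis
qed

text \<open>For \<open>y\<close> between \<open>f c\<close> and \<open>d\<close>, an
  \<open>h\<close> contracting \<open>{c..y}\<close> strongly towards \<open>c\<close> makes
  \<open>h\<close> and \<open>f \<circ> h\<close> a forbidden pair on \<open>{c..y}\<close>: their
  images start at \<open>c\<close> and at \<open>f c\<close>.\<close>

lemma no_image_of_left_end: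
  assumes g: "g \<in> G" "0 \<le> c" "d \<le> 1" "g c = c" "g d = d"
    "\<And>x. c < x \<Longrightarrow> x < d \<Longrightarrow> g x \<noteq> x"
    and f: "f \<in> G" "c < f c" "f c < d"
  shows False
proof -
  obtain y where y: "f c < y" "y < d" using dense f by blast
  obtain k where k: "k \<in> G" "\<And>x. k (f x) = x" "\<And>x. f (k x) = x"
    using inverseE[OF f(1)] by blast
  have "k (f c) < k y" using strict_monoD[OF k(1), of "f c" y] f y g by auto
  \<comment> \<open>Pushing \<open>y\<close> below \<open>f c\<close> separates the two images;
    pushing it below \<open>k y\<close> keeps the second one below \<open>y\<close>.\<close>
  then have "c < min (f c) (k y)" using k f by simp
  then obtain h where h: "h \<in> G" "h c = c" "h y < min (f c) (k y)"
    using ex_push_left[OF g, of y] y f by (metis less_trans)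
  have "c < h y" using strict_monoD[OF h(1), of c y] h y f g by auto
  show False
  proof (rule no_ping_pong[of h "f \<circ> h" c y])
    have "k y \<le> 1" using maps_unit[OF k(1), of y] y f g by simp
    have "f (h y) < f (k y)" using strict_monoD[OF f(1), of "h y" "k y"] h \<open>c < h y\<close> g \<open>k y \<le> 1\<close> by auto
    then show "(f \<circ> h) y \<le> y" using k by simp
  qed (use f g h y comp_in in auto)
qed

text \<open>Mirror image of the previous argument on \<open>{y..d}\<close>. Now the image under
  \<open>f \<circ> h\<close> ends at \<open>f d\<close> and lies to the left, so the two maps change
  roles.\<close>

lemma no_image_of_right_end:
  assumes g: "g \<in> G" "0 \<le> c" "d \<le> 1" "g c = c" "g d = d"
    "\<And>x. c < x \<Longrightarrow> x < d \<Longrightarrow> g x \<noteq> x"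
    and f: "f \<in> G" "c < f d" "f d < d"
  shows False
proof -
  obtain y where y: "c < y" "y < f d" using dense f by blast
  obtain k where k: "k \<in> G" "\<And>x. k (f x) = x" "\<And>x. f (k x) = x"
    using inverseE[OF f(1)] by blast
  have "k y < k (f d)" using strict_monoD[OF k(1), of y "f d"] f y g by auto
  then have t: "c < max (f d) (k y)" "max (f d) (k y) < d" using k f by auto
  then obtain h where h: "h \<in> G" "h d = d" "max (f d) (k y) < h y"
    using ex_push_right[OF g, of y] y f by (metis less_trans)
  have "h y < d" using strict_monoD[OF h(1), of y d] h y f g by auto
  show False
  proof (rule no_ping_pong[of "f \<circ> h" h y d])
    have "0 \<le> k y" using maps_unit[OF k(1), of y] y f g by simp
    have "f (k y) < f (h y)" using strict_monoD[OF f(1), of "k y" "h y"] h \<open>h y < d\<close> g \<open>0 \<le> k y\<close> by auto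
    then show "y \<le> (f \<circ> h) y" using k by simp
  qed (use f g h y comp_in in auto)
qed

text \<open>The one endpoint of \<open>(c,d)\<close> inside \<open>(a,b)\<close> is moved by
  \<open>f\<close> or its inverse into \<open>(c,d)\<close>, as it cannot leave
  \<open>(a,b)\<close>; the two preceding lemmas forbid this.\<close>

lemma not_card_inter_eq_1:
  assumes "successive_fixed_pair G a b" "successive_fixed_pair G c d"
  shows "card ({a<..<b} \<inter> {c, d}) \<noteq> 1"
proof
  assume card: "card ({a<..<b} \<inter> {c, d}) = 1"
  obtain f where f: "f \<in> G" "a < b" "0 \<le> a" "b \<le> 1" "f a = a" "f b = b"
    "\<And>x. a < x \<Longrightarrow> x < b \<Longrightarrow> f x \<noteq> x"
    using assms(1) by (rule successive_fixed_pairE) blast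
  obtain g where g: "g \<in> G" "c < d" "0 \<le> c" "d \<le> 1" "g c = c" "g d = d"
    "\<And>x. c < x \<Longrightarrow> x < d \<Longrightarrow> g x \<noteq> x"
    using assms(2) by (rule successive_fixed_pairE) blast
  obtain k where k: "k \<in> G" "\<And>x. k (f x) = x" "\<And>x. f (k x) = x"
    using inverseE[OF f(1)] by blast
  have kab: "k a = a" "k b = b" using k(2)[of a] k(2)[of b] f by simp_all
  have inside: "a < q e" "q e < b" if "q \<in> {f, k}" "a < e" "e < b" for q e
    using that strict_monoD[of q a e] strict_monoD[of q e b] f k(1) kab by auto
  \<comment> \<open>\<open>f\<close> and \<open>k\<close> move each interior point in opposite
    directions, so the direction can be chosen.\<close>
  have moved: "k e < e \<longleftrightarrow> e < f e" "e < k e \<longleftrightarrow> f e < e" if e: "a < e" "e < b" for e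
  proof -
    have "k e \<noteq> e" using f(7)[OF e] k(3)[of e] by auto
    moreover have "f (k e) < f e" if "k e < e"
      using strict_monoD[OF f(1), of "k e" e] that inside[of k e] e f by auto
    moreover have "f e < f (k e)" if "e < k e"
      using strict_monoD[OF f(1), of e "k e"] that inside[of k e] e f by auto
    ultimately show "k e < e \<longleftrightarrow> e < f e" "e < k e \<longleftrightarrow> f e < e"
      using k(3)[of e] f(7)[OF e] by (smt (verit))+
  qed
  \<comment> \<open>As \<open>c < d\<close>, the endpoint outside \<open>(a,b)\<close> lies at or
    beyond the end of \<open>(a,b)\<close> on its own side.\<close>
  consider "a < c" "c < b" "b \<le> d" | "a < d" "d < b" "c \<le> a"
  proof -
    have "c \<in> {a<..<b} \<or> d \<in> {a<..<b}" using card by (cases "{a<..<b} \<inter> {c, d} = {}") auto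
    moreover have "\<not> (c \<in> {a<..<b} \<and> d \<in> {a<..<b})"
      using card g(2) by (auto simp: Int_absorb1 Int_insert_right)
    ultimately show ?thesis using that g(2) by force
  qed
  then show False
  proof cases
    case 1
    then obtain q where "q \<in> {f, k}" "c < q c"
      using f(7)[of c] moved[of c] by (metis insertCI linorder_neqE)
    then show False
      using no_image_of_left_end[OF g(1,3-7), of q] inside[of q c] 1 f k by auto
  next
    case 2
    then obtain q where "q \<in> {f, k}" "q d < d"
      using f(7)[of d] moved[of d] by (metis insertCI linorder_neqE)
    then show False
      using no_image_of_right_end[OF g(1,3-7), of q] inside[of q d] 2 f k by auto
  qed
qed

end

theorem theoremt:
  fixes G :: "(real \<Rightarrow> real) set"
  assumes "G \<subseteq> Diff1_plus"
    and "is_group G"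
    and "without_hyperbolic_fixed_points G"
  shows "without_linked_fixed_points G"
proof -
  interpret parabolic_group G by (unfold_locales) (fact assms)+
  show ?thesis
    \<comment> \<open>The two disjuncts of \<open>linked\<close> differ by exchanging the pairs, so
      the lemma applies to each.\<close>
    unfolding without_linked_fixed_points_def linked_def using not_card_inter_eq_1 by blast
qed

end
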